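(* Let $G=\langle S\rangle$ be a finitely generated group with finite generating set $S$, and let $X=\Gamma(G,S)$ be its Cayley graph. If there are $a,n\in\mathbb{N}$ with $a\geqslant 100$ and $n\geqslant 2$ such that a sphere of radius $(2a+1)^{n+2}$ in $X$ has at most $n$ elements (that is, $|S(g,(2a+1)^{n+2})|\leqslant n$ for some $g\in G$), then $G$ is virtually cyclic.
   Context: For $g\in G$ and a positive integer $r$, $S(g,r)$ denotes the sphere of radius $r$ centred at $g$ in $\Gamma(G,S)$ with respect to the word metric $d_S$, and $|S(g,r)|$ denotes the number of vertices (elements of $G$) in that sphere. A group is virtually cyclic if it has a cyclic subgroup of finite index (in particular, finite groups are virtually cyclic). *)

theory Defs
  imports "HOL-Algebra.Elementary_Groups"
begin

definition word_dist :: "('a, 'b) monoid_scheme \<Rightarrow> 'a set \<Rightarrow> 'a \<Rightarrow> 'a \<Rightarrow> nat"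
  where "word_dist G S g h =
    (LEAST n. \<exists>ws. set ws \<subseteq> S \<union> m_inv G ` S \<and> length ws = n \<and>
       foldr (\<otimes>\<^bsub>G\<^esub>) ws \<one>\<^bsub>G\<^esub> = inv\<^bsub>G\<^esub> g \<otimes>\<^bsub>G\<^esub> h)"

definition cayley_sphere :: "('a, 'b) monoid_scheme \<Rightarrow> 'a set \<Rightarrow> 'a \<Rightarrow> nat \<Rightarrow> 'a set"
  where "cayley_sphere G S g r = {h \<in> carrier G. word_dist G S g h = r}"

definition virtually_cyclic :: "('a, 'b) monoid_scheme \<Rightarrow> bool"
  where "virtually_cyclic G \<longleftrightarrow>
    (\<exists>H. subgroup H G \<and> cyclic_group (G\<lparr>carrier := H\<rparr>) \<and> finite (rcosets\<^bsub>G\<^esub> H))"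

text \<open>The undirected Cayley graph, as a symmetric adjacency relation on the carrier. If
  \<open>\<one> \<in> S\<close> it has loops, which do not affect distances. The word metric is the path metric of
  this graph, so \<^const>\<open>cayley_sphere\<close> is a sphere of the graph.\<close>

definition cayley_adj :: "('a, 'b) monoid_scheme \<Rightarrow> 'a set \<Rightarrow> ('a \<times> 'a) set"
  where "cayley_adj G S =
    {(g, h). g \<in> carrier G \<and> h \<in> carrier G \<and> (\<exists>s\<in>S. h = g \<otimes>\<^bsub>G\<^esub> s \<or> g = h \<otimes>\<^bsub>G\<^esub> s)}"

context group
begin

lemma foldr_mult_closed:
  "set ws \<subseteq> carrier G \<Longrightarrow> foldr (\<otimes>) ws \<one> \<in> carrier G"
  by (induction ws) auto

lemma cayley_adj_alt:
  assumes "S \<subseteq> carrier G"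
  shows "cayley_adj G S = {(g, g \<otimes> s) | g s. g \<in> carrier G \<and> s \<in> S \<union> m_inv G ` S}"
proof (intro equalityI subsetI)
  fix p assume "p \<in> cayley_adj G S"
  then obtain g h s where p: "p = (g, h)" "g \<in> carrier G" "h \<in> carrier G" "s \<in> S"
    and d: "h = g \<otimes> s \<or> g = h \<otimes> s"
    by (auto simp: cayley_adj_def)
  have "s \<in> carrier G" using p assms by blast
  then have "h = g \<otimes> s \<or> h = g \<otimes> inv s"
    using d p by (auto simp: m_assoc)
  then show "p \<in> {(g, g \<otimes> s) | g s. g \<in> carrier G \<and> s \<in> S \<union> m_inv G ` S}"
    using p by blast
next
  fix p assume "p \<in> {(g, g \<otimes> s) | g s. g \<in> carrier G \<and> s \<in> S \<union> m_inv G ` S}"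
  then obtain g t where p: "p = (g, g \<otimes> t)" "g \<in> carrier G" "t \<in> S \<union> m_inv G ` S"
    by blast
  then consider "t \<in> S" | s where "s \<in> S" "t = inv s" by blast
  then show "p \<in> cayley_adj G S"
  proof cases
    case 1
    then show ?thesis using p assms by (auto simp: cayley_adj_def)
  next
    case 2
    then have "s \<in> carrier G" using assms by blast
    then show ?thesis using 2 p by (auto simp: cayley_adj_def m_assoc intro!: bexI[of _ s])
  qed
qed

lemma cayley_adj_relpow_iff:
  assumes S: "S \<subseteq> carrier G" and "g \<in> carrier G" and h: "h \<in> carrier G"
  shows "(g, h) \<in> cayley_adj G S ^^ n \<longleftrightarrow>
    (\<exists>ws. set ws \<subseteq> S \<union> m_inv G ` S \<and> length ws = n \<and> foldr (\<otimes>) ws \<one> = inv g \<otimes> h)"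
  using assms(2)
proof (induction n arbitrary: g)
  case 0
  have "g = h \<longleftrightarrow> \<one> = inv g \<otimes> h"
    using inv_solve_left[OF one_closed 0 h] 0 by (simp add: eq_commute)
  then show ?case by auto
next
  case (Suc n)
  let ?T = "S \<union> m_inv G ` S"
  have T: "?T \<subseteq> carrier G" using S by auto
  have "(g, h) \<in> cayley_adj G S ^^ Suc n \<longleftrightarrow>
      (\<exists>k. (g, k) \<in> cayley_adj G S \<and> (k, h) \<in> cayley_adj G S ^^ n)"
    by (blast intro: relpow_Suc_I2 dest: relpow_Suc_D2)
  also have "\<dots> \<longleftrightarrow> (\<exists>t\<in>?T. (g \<otimes> t, h) \<in> cayley_adj G S ^^ n)"
    using Suc.prems by (auto simp: cayley_adj_alt[OF S])
  also have "\<dots> \<longleftrightarrow> (\<exists>t\<in>?T. \<exists>ws. set ws \<subseteq> ?T \<and> length ws = n \<and>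
      foldr (\<otimes>) ws \<one> = inv (g \<otimes> t) \<otimes> h)"
    by (intro bex_cong refl Suc.IH m_closed Suc.prems subsetD[OF T])
  also have "\<dots> \<longleftrightarrow> (\<exists>t\<in>?T. \<exists>ws. set ws \<subseteq> ?T \<and> length ws = n \<and>
      t \<otimes> foldr (\<otimes>) ws \<one> = inv g \<otimes> h)"
  proof (intro bex_cong ex_cong1 conj_cong refl)
    fix t ws assume "t \<in> ?T" "set ws \<subseteq> ?T" "length ws = n"
    then have tc: "t \<in> carrier G" and wc: "foldr (\<otimes>) ws \<one> \<in> carrier G"
      using T foldr_mult_closed by blast+
    have "inv (g \<otimes> t) \<otimes> h = inv t \<otimes> (inv g \<otimes> h)"
      using tc Suc.prems h by (simp add: inv_mult_group m_assoc)
    then show "(foldr (\<otimes>) ws \<one> = inv (g \<otimes> t) \<otimes> h) = (t \<otimes> foldr (\<otimes>) ws \<one> = inv g \<otimes> h)"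
      using inv_solve_left[OF wc tc, of "inv g \<otimes> h"] Suc.prems h
      by (simp add: eq_commute)
  qed
  also have "\<dots> \<longleftrightarrow> (\<exists>ws. set ws \<subseteq> ?T \<and> length ws = Suc n \<and> foldr (\<otimes>) ws \<one> = inv g \<otimes> h)"
    (is "?L \<longleftrightarrow> ?R")
  proof
    assume ?L
    then obtain t ws where "t \<in> ?T" "set ws \<subseteq> ?T" "length ws = n"
      "t \<otimes> foldr (\<otimes>) ws \<one> = inv g \<otimes> h" by blast
    then show ?R by (intro exI[of _ "t # ws"]) auto
  next
    assume ?R
    then show ?L by (fastforce simp: length_Suc_conv)
  qed
  finally show ?case .
qed

lemma word_dist_eq_path_dist:
  assumes "S \<subseteq> carrier G" "g \<in> carrier G" "h \<in> carrier G"
  shows "word_dist G S g h = (LEAST n. (g, h) \<in> cayley_adj G S ^^ n)"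
  by (simp add: word_dist_def cayley_adj_relpow_iff[OF assms])

end

end

theory Submission
  imports Defs
begin

text \<open>Choose for each group element its shortlex-minimal word over the symmetrised generators. Every
  factor of such a normal form is again a normal form, so a normal form has at most \<open>n\<close> distinct
  factors of the length \<open>R = (2 a + 1) ^ (n + 2) \<ge> n\<close>. As in the Morse--Hedlund theorem it follows
  that the normal forms are \<open>x @ u ^ m @ y\<close> with \<open>x\<close>, \<open>u\<close>, \<open>y\<close> of bounded length. Since
  \<open>x u\<^sup>m y = (x u x\<^sup>-\<^sup>1)\<^sup>m (x y)\<close>, the group is a finite union of cosets of cyclic subgroups, and by
  B. H. Neumann's lemma one of these has finite index.\<close>

section \<open>Words with few factors\<close>

text \<open>Since \<open>h\<close> maps the finite image of \<open>f\<close> onto that of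
  \<open>g\<close>, which is at least as large, it is injective there. With
  \<open>h = take k\<close> this says that a factor of length \<open>k\<close> determines its next
  letter.\<close>

lemma card_eq_imp_inj_on_factor:
  assumes "finite I" and "card (f ` I) \<le> card (g ` I)" and "\<And>i. i \<in> I \<Longrightarrow> g i = h (f i)"
    and "i \<in> I" "j \<in> I" "g i = g j"
  shows "f i = f j"
proof -
  have "g ` I = h ` f ` I"
    using assms(3) by force
  then have "inj_on h (f ` I)"
    using assms(1,2) by (metis card_image_le eq_card_imp_inj_on finite_imageI le_antisym)
  then show ?thesis
    using assms(3-6) by (simp add: inj_on_eq_iff)
qed

text \<open>Strict growth at every \<open>k < n\<close>, from a positive start, would force
  \<open>f k > k\<close> all the way up to \<open>f n > n\<close>. Applied to factor counts, it
  yields a length at which one more letter creates no new factors.\<close>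

lemma nat_seq_repeats_below:
  fixes f :: "nat \<Rightarrow> nat"
  assumes "0 < f 0" and "f n \<le> n"
  shows "\<exists>k<n. f (Suc k) \<le> f k"
proof (rule ccontr)
  assume "\<not> ?thesis"
  then have step: "k < n \<Longrightarrow> Suc (f k) \<le> f (Suc k)" for k
    by (auto simp: not_le Suc_le_eq)
  have "k \<le> n \<Longrightarrow> k < f k" for k
  proof (induction k)
    case (Suc k)
    then show ?case
      using step[of k] by linarith
  qed (use assms in simp)
  then show False
    using assms(2) by fastforce
qed

text \<open>A finite form of the Morse-Hedlund argument: for some \<open>k < n\<close> every factor
  of length \<open>k\<close> determines its next letter, and two early positions carry the same such
  factor. From there on both readings of \<open>w\<close> agree, so the distance of the two
  positions is a period.\<close>

lemma eventually_periodic_of_few_factors: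
  fixes w :: "'a list"
  assumes "n \<le> R" and len: "R + n \<le> length w"
    and few: "card ((\<lambda>i. take R (drop i w)) ` {..length w - R}) \<le> n"
  shows "\<exists>s p. 0 < p \<and> p \<le> n \<and> s \<le> 2 * n \<and>
    (\<forall>t. s + p + t < length w - R \<longrightarrow> w ! (s + p + t) = w ! (s + t))"
proof -
  \<comment> \<open>Exactly the positions at which a window of length \<open>R\<close> fits. Using
    them for all lengths up to \<open>R\<close> ensures that no window is cut off.\<close>
  define I where "I = {..length w - R}"
  define win where "win k i = take k (drop i w)" for k i
  \<comment> \<open>Shorter windows are prefixes of windows of length \<open>R\<close>, so they are
    at most as numerous.\<close>
  have "win n i = take n (win R i)" for i
    using \<open>n \<le> R\<close> by (simp add: win_def)
  then have "win n ` I = take n ` win R ` I"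
    by (auto simp: image_image)
  then have cn: "card (win n ` I) \<le> n"
    using few card_image_le[of "win R ` I" "take n"] by (simp add: I_def win_def[abs_def])
  moreover have "0 < card (win 0 ` I)"
    by (auto simp: I_def win_def card_gt_0_iff)
  ultimately obtain k where k: "k < n" and ck: "card (win (Suc k) ` I) \<le> card (win k ` I)"
    using nat_seq_repeats_below[of "\<lambda>k. card (win k ` I)" n] by blast
  have det: "win (Suc k) i = win (Suc k) j" if "i \<in> I" "j \<in> I" "win k i = win k j" for i j
    by (rule card_eq_imp_inj_on_factor[OF _ ck, of "take k"]) (use that in \<open>auto simp: I_def win_def\<close>)
  have "win k i = take k (win n i)" for i
    using \<open>k < n\<close> by (simp add: win_def min_def)
  then have "win k ` I = take k ` win n ` I"
    by (auto simp: image_image)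
  then have "card (win k ` I) \<le> n"
    using cn card_image_le[of "win n ` I" "take k"] by (simp add: I_def)
  \<comment> \<open>Pigeonhole: the \<open>n + 1\<close> positions up to \<open>n\<close> carry at
    most \<open>n\<close> distinct windows of length \<open>k\<close>.\<close>
  moreover have "win k ` {..n} \<subseteq> win k ` I"
    using len by (auto simp: I_def)
  ultimately have "card (win k ` {..n}) < card {..n}"
    using card_mono[of "win k ` I" "win k ` {..n}"] by (simp add: I_def)
  then have "\<not> inj_on (win k) {..n}"
    using card_image by fastforce
  then obtain i j where ij: "i < j" "j \<le> n" "win k i = win k j"
    unfolding inj_on_def by (metis atMost_iff linorder_neqE_nat)
  \<comment> \<open>Equal windows of length \<open>k\<close> extend to equal windows of length
    \<open>Suc k\<close>; dropping the first letter moves both one position to the right.\<close>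
  have "win k (i + t) = win k (j + t)" if "j + t \<le> length w - R" for t
    using that
  proof (induction t)
    case 0
    then show ?case using ij by simp
  next
    case (Suc t)
    then have "win (Suc k) (i + t) = win (Suc k) (j + t)"
      using ij by (intro det) (auto simp: I_def)
    then have "drop 1 (win (Suc k) (i + t)) = drop 1 (win (Suc k) (j + t))"
      by simp
    then show ?case
      by (simp add: win_def drop_take)
  qed
  then have w: "win (Suc k) (i + t) = win (Suc k) (j + t)" if "j + t \<le> length w - R" for t
    using that ij by (intro det) (auto simp: I_def)
  have "w ! (i + t + k) = w ! (j + t + k)" if "j + t \<le> length w - R" for t
  proof -
    have "j + t + k < length w"
      using that k \<open>n \<le> R\<close> len by linarith
    then show ?thesis
      using arg_cong[OF w[OF that], of "\<lambda>v. v ! k"] ij by (simp add: win_def)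
  qed
  note per = this
  \<comment> \<open>The period is \<open>j - i\<close>. The compared letters lie just behind windows
    of length \<open>k\<close>, so periodicity starts at \<open>i + k\<close>, which is at most
    \<open>2 * n\<close>.\<close>
  have "w ! (i + k + (j - i) + t) = w ! (i + k + t)" if "i + k + (j - i) + t < length w - R" for t
    using per[of t] that ij by (simp add: ac_simps)
  then show ?thesis
    using ij k by (intro exI[of _ "i + k"] exI[of _ "j - i"]) auto
qed

lemma take_periodic_eq_concat_replicate:
  assumes "\<And>t. s + p + t < M \<Longrightarrow> w ! (s + p + t) = w ! (s + t)"
    and "s + m * p \<le> M" and "M \<le> length w"
  shows "take (m * p) (drop s w) = concat (replicate m (take p (drop s w)))"
  using assms(2)
proof (induction m)
  case (Suc m)
  have "take (m * p) (drop (s + p) w) = take (m * p) (drop s w)"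
    using Suc.prems assms(1,3) by (intro nth_equalityI) auto
  then show ?case
    using Suc by (simp add: take_add add.commute)
qed simp

lemma few_factors_decomp:
  fixes w :: "'a list"
  assumes "n \<le> R" and few: "card ((\<lambda>i. take R (drop i w)) ` {..length w - R}) \<le> n"
  shows "\<exists>x u y m. w = x @ concat (replicate m u) @ y \<and>
    length x \<le> R + 2 * n \<and> length u \<le> R + 2 * n \<and> length y \<le> R + 2 * n"
proof (cases "length w \<le> R + 2 * n")
  case True
  then show ?thesis
    by (intro exI[of _ w] exI[of _ "[]"] exI[of _ 0]) simp
next
  case False
  define M where "M = length w - R"
  obtain s p where sp: "0 < p" "p \<le> n" "s \<le> 2 * n"
    and per: "\<And>t. s + p + t < M \<Longrightarrow> w ! (s + p + t) = w ! (s + t)"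
    using eventually_periodic_of_few_factors[OF \<open>n \<le> R\<close> _ few] False by (auto simp: M_def)
  \<comment> \<open>The number of whole periods between \<open>s\<close> and \<open>M\<close>.
    Behind them come fewer than \<open>p\<close> letters and then the last \<open>R\<close> letters,
    where periodicity is not known; together they form \<open>y\<close>.\<close>
  define m where "m = (M - s) div p"
  have m: "m * p \<le> M - s" "M - s < m * p + p"
    using \<open>0 < p\<close> dividend_less_div_times[of p "M - s"] by (simp_all add: m_def add.commute)
  have "s \<le> M"
    using sp False by (simp add: M_def)
  have "w = take s w @ take (m * p) (drop s w) @ drop (m * p) (drop s w)"
    by (simp only: append_take_drop_id)
  also have "take (m * p) (drop s w) = concat (replicate m (take p (drop s w)))"
    by (rule take_periodic_eq_concat_replicate[OF per]) (use m \<open>s \<le> M\<close> M_def in auto)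
  finally have "w = take s w @ concat (replicate m (take p (drop s w))) @ drop (m * p) (drop s w)" .
  moreover have "length w - (s + m * p) \<le> R + 2 * n"
    using sp m False \<open>s \<le> M\<close> M_def by linarith
  then have "length (take s w) \<le> R + 2 * n" "length (take p (drop s w)) \<le> R + 2 * n"
    "length (drop (m * p) (drop s w)) \<le> R + 2 * n"
    using sp by (simp_all add: add.commute)
  ultimately show ?thesis
    by blast
qed

section \<open>Coverings by cosets\<close>

context group
begin

lemma mult_inv_mult_cancel [simp]:
  assumes "x \<in> carrier G" "y \<in> carrier G"
  shows "x \<otimes> (inv x \<otimes> y) = y" "inv x \<otimes> (x \<otimes> y) = y"
  using assms by (simp_all flip: m_assoc)

lemma Neumann_finite_index:
  assumes "finite \<H>" and "finite X" and "X \<subseteq> carrier G"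
    and "\<And>H. H \<in> \<H> \<Longrightarrow> subgroup H G"
    and "carrier G = (\<Union>H\<in>\<H>. \<Union>x\<in>X. H #> x)"
  shows "\<exists>H\<in>\<H>. finite (rcosets H)"
  using assms
proof (induction \<H> arbitrary: X rule: finite_induct)
  case empty
  then show ?case
    using one_closed by auto
next
  case (insert K \<H>)
  interpret K: subgroup K G
    using insert.prems by simp
  show ?case
  proof (cases "\<forall>c\<in>carrier G. \<exists>x\<in>X. c \<in> K #> x")
    case True
    then have "rcosets K \<subseteq> (\<lambda>x. K #> x) ` X"
      using repr_independence[OF _ _ K.subgroup_axioms] insert.prems(2)
      by (fastforce simp: RCOSETS_def)
    then have "finite (rcosets K)"
      using insert.prems(1) finite_surj by blast
    then show ?thesis by blast
  next
    case False
    then obtain c where c: "c \<in> carrier G" "\<And>x. x \<in> X \<Longrightarrow> c \<notin> K #> x"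
      by blast
    \<comment> \<open>Old representatives serve the cosets already belonging to other subgroups; the
      elements \<open>x' c\<^sup>-\<^sup>1 x\<close> arise when a covering of \<open>K c\<close> is
      translated to one of \<open>K x\<close>.\<close>
    define Y where "Y = X \<union> (\<lambda>(x', x). x' \<otimes> (inv c \<otimes> x)) ` (X \<times> X)"
    have Y: "finite Y" "Y \<subseteq> carrier G"
      using insert.prems(1,2) c by (auto simp: Y_def)
    have "g \<in> (\<Union>H\<in>\<H>. \<Union>x\<in>Y. H #> x)" if g: "g \<in> carrier G" for g
    proof -
      obtain H x where H: "H \<in> insert K \<H>" "x \<in> X" "g \<in> H #> x"
        using g insert.prems(4) by blast
      show ?thesis
      proof (cases "H \<in> \<H>")
        case True
        then show ?thesis using H by (auto simp: Y_def)
      next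
        case False
        then have "g \<in> K #> x" using H by blast
        then obtain k where k: "k \<in> K" "g = k \<otimes> x"
          by (auto simp: r_coset_def)
        have xc: "x \<in> carrier G" using H insert.prems by blast
        have kc: "k \<in> carrier G" using k by simp
        \<comment> \<open>The coset of \<open>c\<close> misses all cosets of \<open>K\<close> in the covering, so the other subgroups
            cover it; translating on the right, they also cover the coset of \<open>x\<close>.\<close>
        have "k \<otimes> c \<in> carrier G" using kc c by simp
        then obtain H' x' where H': "H' \<in> insert K \<H>" "x' \<in> X" "k \<otimes> c \<in> H' #> x'"
          using insert.prems(4) by blast
        have x'c: "x' \<in> carrier G" using H' insert.prems by blast
        have "k \<otimes> c \<notin> K #> x'"
        proof
          assume "k \<otimes> c \<in> K #> x'"
          then obtain l where "l \<in> K" "k \<otimes> c = l \<otimes> x'"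
            by (auto simp: r_coset_def)
          then have "c = (inv k \<otimes> l) \<otimes> x'"
            using kc c x'c by (metis K.mem_carrier inv_closed inv_solve_left m_assoc m_closed)
          then have "c \<in> K #> x'"
            using \<open>l \<in> K\<close> k by (auto simp: r_coset_def)
          then show False using c H' by blast
        qed
        then have H'in: "H' \<in> \<H>" using H' by blast
        obtain h where h: "h \<in> H'" "k \<otimes> c = h \<otimes> x'"
          using H' by (auto simp: r_coset_def)
        have hc: "h \<in> carrier G"
          using subgroup.mem_carrier[OF insert.prems(3)[OF H'(1)] h(1)] .
        have "g = (k \<otimes> c) \<otimes> (inv c \<otimes> x)"
          using k kc c xc by (simp add: m_assoc)
        also have "\<dots> = h \<otimes> (x' \<otimes> (inv c \<otimes> x))"
          using h hc x'c xc c by (simp add: m_assoc)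
        finally have "g \<in> H' #> (x' \<otimes> (inv c \<otimes> x))"
          using h by (auto simp: r_coset_def)
        then show ?thesis
          using H'in H' H by (force simp: Y_def)
      qed
    qed
    moreover have "(\<Union>H\<in>\<H>. \<Union>x\<in>Y. H #> x) \<subseteq> carrier G"
      using Y insert.prems(3) by (intro UN_least r_coset_subset_G subgroup.subset) auto
    ultimately have "\<exists>H\<in>\<H>. finite (rcosets H)"
      using Y insert.prems(3) by (intro insert.IH[of Y] equalityI subsetI) auto
    then show ?thesis by blast
  qed
qed

lemma conj_nat_pow:
  fixes m :: nat
  assumes "x \<in> carrier G" "u \<in> carrier G"
  shows "(x \<otimes> u \<otimes> inv x) [^] m = x \<otimes> u [^] m \<otimes> inv x"
proof (induction m)
  case (Suc m)
  then show ?case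
    using assms by (simp add: m_assoc)
qed (use assms in simp)

lemma virtually_cyclic_if_covered:
  assumes "finite E" and "E \<subseteq> carrier G"
    and cover: "\<And>g. g \<in> carrier G \<Longrightarrow> \<exists>x\<in>E. \<exists>u\<in>E. \<exists>y\<in>E. \<exists>m::nat. g = x \<otimes> u [^] m \<otimes> y"
  shows "virtually_cyclic G"
proof -
  \<comment> \<open>The cyclic subgroups generated by the conjugates, with the products
    \<open>x y\<close> as coset representatives in \<open>X\<close>; both families are finite
    because \<open>E\<close> is.\<close>
  define \<H> where "\<H> = (\<lambda>(x, u). generate G {x \<otimes> u \<otimes> inv x}) ` (E \<times> E)"
  define X where "X = (\<lambda>(x, y). x \<otimes> y) ` (E \<times> E)"
  have sub: "subgroup H G" if "H \<in> \<H>" for H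
    using that assms(2) by (auto simp: \<H>_def intro!: generate_is_subgroup)
  have X: "finite X" "X \<subseteq> carrier G"
    using assms(1,2) by (auto simp: X_def)
  have "g \<in> (\<Union>H\<in>\<H>. \<Union>x\<in>X. H #> x)" if g: "g \<in> carrier G" for g
  proof -
    obtain x u y and m :: nat where xuy: "x \<in> E" "u \<in> E" "y \<in> E" "g = x \<otimes> u [^] m \<otimes> y"
      using cover[OF g] by blast
    then have c: "x \<in> carrier G" "u \<in> carrier G" "y \<in> carrier G"
      using assms(2) by auto
    have "g = (x \<otimes> u \<otimes> inv x) [^] m \<otimes> (x \<otimes> y)"
      unfolding conj_nat_pow[OF c(1,2)] using c xuy by (simp add: m_assoc)
    moreover have "(x \<otimes> u \<otimes> inv x) [^] m \<in> generate G {x \<otimes> u \<otimes> inv x}"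
      using c generate_pow[of "x \<otimes> u \<otimes> inv x"] by (auto simp flip: int_pow_int)
    ultimately have "g \<in> generate G {x \<otimes> u \<otimes> inv x} #> (x \<otimes> y)"
      by (auto simp: r_coset_def)
    then show ?thesis
      using xuy by (force simp: \<H>_def X_def)
  qed
  moreover have "(\<Union>H\<in>\<H>. \<Union>x\<in>X. H #> x) \<subseteq> carrier G"
    using X sub by (intro UN_least r_coset_subset_G subgroup.subset) auto
  ultimately have "carrier G = (\<Union>H\<in>\<H>. \<Union>x\<in>X. H #> x)"
    by (intro equalityI subsetI) auto
  moreover have "finite \<H>"
    using assms(1) by (simp add: \<H>_def)
  ultimately obtain H where "H \<in> \<H>" and fin: "finite (rcosets H)"
    using Neumann_finite_index[OF _ X sub] by blast
  then obtain x u where "x \<in> E" "u \<in> E" and H: "H = generate G {x \<otimes> u \<otimes> inv x}"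
    by (auto simp: \<H>_def)
  then have "x \<otimes> u \<otimes> inv x \<in> carrier G"
    using assms(2) by auto
  then have "cyclic_group (G\<lparr>carrier := H\<rparr>)"
    using cyclic_group_generated[of "x \<otimes> u \<otimes> inv x"] H by (simp add: subgroup_generated_def)
  then show ?thesis
    using fin sub[OF \<open>H \<in> \<H>\<close>] by (auto simp: virtually_cyclic_def)
qed

section \<open>Shortlex normal forms\<close>

abbreviation word_val :: "'a list \<Rightarrow> 'a"
  where "word_val ws \<equiv> foldr (\<otimes>) ws \<one>"

lemma word_val_append:
  assumes "set vs \<subseteq> carrier G" "set ws \<subseteq> carrier G"
  shows "word_val (vs @ ws) = word_val vs \<otimes> word_val ws"
  using assms by (induction vs) (auto simp: foldr_mult_closed m_assoc)

lemma word_val_concat_replicate: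
  assumes "set u \<subseteq> carrier G"
  shows "word_val (concat (replicate m u)) = word_val u [^] m"
proof (induction m)
  case (Suc m)
  have "set (concat (replicate m u)) \<subseteq> carrier G"
    using assms by (auto split: if_splits)
  then show ?case
    using Suc assms nat_pow_Suc2[OF foldr_mult_closed[OF assms]]
    by (simp add: word_val_append del: foldr_append)
qed simp

lemma generate_imp_word:
  assumes "S \<subseteq> carrier G" and "g \<in> generate G S"
  shows "\<exists>ws\<in>lists (S \<union> m_inv G ` S). word_val ws = g"
  using assms(2)
proof induction
  case one
  then show ?case by (intro bexI[of _ "[]"]) auto
next
  case (incl h)
  then show ?case using assms(1) by (intro bexI[of _ "[h]"]) auto
next
  case (inv h)
  then show ?case using assms(1) by (intro bexI[of _ "[inv h]"]) auto
next
  case (eng h1 h2)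
  then obtain vs ws where vs: "vs \<in> lists (S \<union> m_inv G ` S)" "word_val vs = h1"
    and ws: "ws \<in> lists (S \<union> m_inv G ` S)" "word_val ws = h2"
    by blast
  have "S \<union> m_inv G ` S \<subseteq> carrier G"
    using assms(1) by auto
  then have "vs \<in> lists (carrier G)" "ws \<in> lists (carrier G)"
    using vs(1) ws(1) lists_mono by blast+
  then have "word_val (vs @ ws) = h1 \<otimes> h2"
    using vs(2) ws(2) word_val_append[of vs ws] by auto
  then show ?case
    using vs ws by (intro bexI[of _ "vs @ ws"]) auto
qed

text \<open>\<open>lenlex\<close> compares lengths first, so minimal words are geodesic. Minimality
  says that no word with the same value is smaller, for any relation \<open>r\<close> on the
  letters; totality and well-foundedness of \<open>r\<close> then give uniqueness and
  existence.\<close>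

definition shortlex_words :: "'a rel \<Rightarrow> 'a set \<Rightarrow> 'a list set"
  where "shortlex_words r T =
    {ws \<in> lists T. \<forall>vs\<in>lists T. word_val vs = word_val ws \<longrightarrow> (vs, ws) \<notin> lenlex r}"

lemma shortlex_words_exist:
  assumes "wf r" and "ws \<in> lists T"
  shows "\<exists>vs\<in>shortlex_words r T. word_val vs = word_val ws"
proof -
  let ?Q = "{vs \<in> lists T. word_val vs = word_val ws}"
  have "ws \<in> ?Q"
    using assms by simp
  then obtain vs where "vs \<in> ?Q" "\<forall>v. (v, vs) \<in> lenlex r \<longrightarrow> v \<notin> ?Q"
    by (rule wfE_min[OF wf_lenlex[OF assms(1)]]) blast
  then show ?thesis
    by (intro bexI[of _ vs]) (auto simp: shortlex_words_def)
qed

lemma inj_on_word_val_shortlex_words: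
  assumes "total r"
  shows "inj_on word_val (shortlex_words r T)"
  using total_lenlex[OF assms]
  by (fastforce simp: inj_on_def shortlex_words_def total_on_def)

text \<open>Replacing a factor by a smaller word of the same value would make the whole word smaller
  without changing its value, as \<open>lenlex\<close> respects common prefixes and
  suffixes.\<close>

lemma shortlex_words_factor:
  assumes "T \<subseteq> carrier G" and "irrefl r" and "x @ v @ y \<in> shortlex_words r T"
  shows "v \<in> shortlex_words r T"
proof -
  have in_T: "x \<in> lists T" "v \<in> lists T" "y \<in> lists T"
    using assms(3) by (auto simp: shortlex_words_def)
  have "(u, v) \<notin> lenlex r" if "u \<in> lists T" "word_val u = word_val v" for u
  proof
    assume "(u, v) \<in> lenlex r"
    then have "(x @ u @ y, x @ v @ y) \<in> lenlex r"
      using assms(2) by (simp add: lenlex_append1)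
    moreover have "set x \<subseteq> carrier G" "set u \<subseteq> carrier G" "set v \<subseteq> carrier G" "set y \<subseteq> carrier G"
      using in_T that(1) assms(1) by auto
    then have "word_val (x @ u @ y) = word_val (x @ v @ y)"
      using that(2) by (simp add: word_val_append del: foldr_append)
    ultimately show False
      using assms(3) in_T that(1) by (simp add: shortlex_words_def)
  qed
  then show ?thesis
    using in_T by (simp add: shortlex_words_def)
qed

lemma length_shortlex_word:
  assumes "ws \<in> shortlex_words r (S \<union> m_inv G ` S)"
    and "inv g \<otimes> h = word_val ws"
  shows "word_dist G S g h = length ws"
  unfolding word_dist_def
proof (rule Least_equality)
  show "\<exists>vs. set vs \<subseteq> S \<union> m_inv G ` S \<and> length vs = length ws \<and> word_val vs = inv g \<otimes> h"
    using assms by (auto simp: shortlex_words_def)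
next
  fix n assume "\<exists>vs. set vs \<subseteq> S \<union> m_inv G ` S \<and> length vs = n \<and> word_val vs = inv g \<otimes> h"
  then obtain vs where "vs \<in> lists (S \<union> m_inv G ` S)" "length vs = n" "word_val vs = word_val ws"
    using assms(2) by auto
  then show "length ws \<le> n"
    using assms(1) by (auto simp: shortlex_words_def lenlex_conv not_less)
qed

text \<open>Distinct normal forms have distinct values, and left translation by \<open>g\<close>
  carries the values of those of length \<open>R\<close> into the sphere around
  \<open>g\<close>.\<close>

lemma card_shortlex_words_le:
  assumes "finite S" "S \<subseteq> carrier G" "generate G S = carrier G" "g \<in> carrier G" "wf r" "total r"
  shows "card {ws \<in> shortlex_words r (S \<union> m_inv G ` S). length ws = R}
    \<le> card (cayley_sphere G S g R)"
proof (rule card_inj_on_le)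
  let ?T = "S \<union> m_inv G ` S"
  let ?L = "shortlex_words r ?T"
  have T: "?T \<subseteq> carrier G"
    using assms(2) by auto
  have val: "word_val ws \<in> carrier G" if "ws \<in> ?L" for ws
    using that T by (intro foldr_mult_closed) (auto simp: shortlex_words_def)
  show "inj_on (\<lambda>ws. g \<otimes> word_val ws) {ws \<in> ?L. length ws = R}"
    using inj_on_word_val_shortlex_words[OF assms(6)] val assms(4)
    by (auto simp: inj_on_def)
  show "(\<lambda>ws. g \<otimes> word_val ws) ` {ws \<in> ?L. length ws = R} \<subseteq> cayley_sphere G S g R"
  proof clarify
    fix ws assume ws: "ws \<in> ?L"
    then have "inv g \<otimes> (g \<otimes> word_val ws) = word_val ws"
      using val assms(4) by (simp add: m_assoc[symmetric])
    then show "g \<otimes> word_val ws \<in> cayley_sphere G S g (length ws)"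
      using length_shortlex_word[OF ws] val[OF ws] assms(4) by (simp add: cayley_sphere_def)
  qed
  \<comment> \<open>The sphere must be shown finite, since \<open>card\<close> is 0 on infinite
    sets: each of its elements comes from a word of length \<open>R\<close> over a finite
    alphabet.\<close>
  have "h \<in> (\<lambda>ws. g \<otimes> word_val ws) ` {ws. set ws \<subseteq> ?T \<and> length ws = R}"
    if "h \<in> cayley_sphere G S g R" for h
  proof -
    have h: "h \<in> carrier G" "word_dist G S g h = R"
      using that by (auto simp: cayley_sphere_def)
    then have "inv g \<otimes> h \<in> generate G S"
      using assms(3,4) by simp
    then obtain vs where "vs \<in> lists ?T" "word_val vs = inv g \<otimes> h"
      using generate_imp_word[OF assms(2)] by blast
    then obtain ws where ws: "ws \<in> ?L" "word_val ws = inv g \<otimes> h"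
      using shortlex_words_exist[OF assms(5)] by metis
    then have "length ws = R"
      using length_shortlex_word[OF ws(1), of g h] h by simp
    moreover have "h = g \<otimes> word_val ws"
      using ws h assms(4) by (simp add:)
    ultimately show ?thesis
      using ws(1) by (intro image_eqI[of _ _ ws]) (auto simp: shortlex_words_def)
  qed
  moreover have "finite {ws. set ws \<subseteq> ?T \<and> length ws = R}"
    using assms(1) by (intro finite_lists_length_eq) simp
  ultimately show "finite (cayley_sphere G S g R)"
    by (meson finite_surj subsetI)
qed

lemma virtually_cyclic_if_small_sphere:
  assumes "finite S" "S \<subseteq> carrier G" "generate G S = carrier G" "g \<in> carrier G"
    and "n \<le> R" and "card (cayley_sphere G S g R) \<le> n"
  shows "virtually_cyclic G"
proof -
  let ?T = "S \<union> m_inv G ` S"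
  have T: "?T \<subseteq> carrier G" "finite ?T"
    using assms(1,2) by auto
  obtain r0 :: "'a rel" where "well_order_on UNIV r0"
    using well_order_on by blast
  \<comment> \<open>A well-order is reflexive, whereas \<open>lenlex\<close> requires its strict
    part.\<close>
  moreover define r where "r = r0 - Id"
  ultimately have r: "wf r" "total r" "irrefl r"
    by (auto simp: well_order_on_def linear_order_on_def total_on_def irrefl_def)
  define L where "L = shortlex_words r ?T"
  define B where "B = {ws. set ws \<subseteq> ?T \<and> length ws \<le> R + 2 * n}"
  have fin: "finite {ws \<in> L. length ws = R}"
    by (rule finite_subset[OF _ finite_lists_length_eq[OF T(2), of R]])
      (auto simp: L_def shortlex_words_def)
  show ?thesis
  proof (rule virtually_cyclic_if_covered[of "word_val ` B"])
    show "finite (word_val ` B)"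
      unfolding B_def using finite_lists_length_le[OF T(2)] by blast
    show "word_val ` B \<subseteq> carrier G"
      using subset_trans[OF _ T(1)] by (auto simp del: Un_subset_iff simp: B_def intro!: foldr_mult_closed)
    fix h assume "h \<in> carrier G"
    then obtain vs where "vs \<in> lists ?T" "word_val vs = h"
      using generate_imp_word[OF assms(2)] assms(3) by blast
    then obtain w where w: "w \<in> L" "word_val w = h"
      using shortlex_words_exist[OF r(1)] unfolding L_def by metis
    have wT: "set w \<subseteq> ?T"
      using w by (auto simp: L_def shortlex_words_def)
    have "\<exists>x u y m. w = x @ concat (replicate m u) @ y \<and>
      length x \<le> R + 2 * n \<and> length u \<le> R + 2 * n \<and> length y \<le> R + 2 * n"
    \<comment> \<open>In a word shorter than \<open>R\<close>, truncated subtraction leaves only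
      position 0, whose window is too short to be counted by the sphere; such a word is decomposed
      with \<open>m = 0\<close>.\<close>
    proof (cases "R \<le> length w")
      case True
      have "take R (drop i w) \<in> L" for i
        using shortlex_words_factor[OF T(1) r(3), of "take i w" "take R (drop i w)"
            "drop R (drop i w)"] w unfolding L_def append_take_drop_id by simp
      then have "(\<lambda>i. take R (drop i w)) ` {..length w - R} \<subseteq> {ws \<in> L. length ws = R}"
        using True by auto
      then have "card ((\<lambda>i. take R (drop i w)) ` {..length w - R}) \<le> n"
        using card_mono[OF fin] card_shortlex_words_le[OF assms(1-4) r(1,2), of R] assms(6)
        unfolding L_def by (meson le_trans)
      then show ?thesis
        by (rule few_factors_decomp[OF assms(5)])
    next
      case False
      then show ?thesis
        by (intro exI[of _ w] exI[of _ "[]"] exI[of _ 0]) simp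
    qed
    then obtain x u y m where xuy: "w = x @ concat (replicate m u) @ y"
      "length x \<le> R + 2 * n" "length u \<le> R + 2 * n" "length y \<le> R + 2 * n"
      by blast
    \<comment> \<open>If \<open>m = 0\<close>, the letters of \<open>u\<close> do not occur in
      \<open>w\<close> through the repetition and need not be generators; the empty word replaces
      \<open>u\<close> then.\<close>
    define u' where "u' = (if m = 0 then [] else u)"
    have u': "w = x @ concat (replicate m u') @ y" "length u' \<le> R + 2 * n"
      using xuy by (auto simp: u'_def)
    then have sets: "set x \<subseteq> ?T" "set u' \<subseteq> ?T" "set y \<subseteq> ?T"
      using wT by (auto simp: u'_def split: if_splits)
    then have "set x \<subseteq> carrier G" "set u' \<subseteq> carrier G" "set y \<subseteq> carrier G"
      using T(1) by blast+
    moreover from this have "set (concat (replicate m u')) \<subseteq> carrier G"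
      by auto
    ultimately have "h = word_val x \<otimes> word_val u' [^] m \<otimes> word_val y"
      using w(2) u'(1)
      by (simp add: word_val_append word_val_concat_replicate foldr_mult_closed m_assoc del: set_concat foldr_append)
    then show "\<exists>x\<in>word_val ` B. \<exists>u\<in>word_val ` B. \<exists>y\<in>word_val ` B. \<exists>m::nat. h = x \<otimes> u [^] m \<otimes> y"
      using sets xuy u' unfolding B_def by blast
  qed
qed

end

theorem theorem4:
  fixes G (structure) and S :: "'a set" and g :: 'a and a n :: nat
  assumes "group G"
    and "finite S" and "S \<subseteq> carrier G" and "generate G S = carrier G"
    and "a \<ge> 100" and "n \<ge> 2"
    and "g \<in> carrier G"
    and "card (cayley_sphere G S g ((2 * a + 1) ^ (n + 2))) \<le> n"
  shows "virtually_cyclic G"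
proof -
  \<comment> \<open>By \<open>k < b ^ k\<close> for \<open>b > 1\<close>, the radius exceeds
    \<open>n\<close>, as the bound on factor counts requires.\<close>
  have "n + 2 < (2 * a + 1) ^ (n + 2)"
    using \<open>a \<ge> 100\<close> by (intro power_gt_expt) simp
  then show ?thesis
    using group.virtually_cyclic_if_small_sphere[OF assms(1-4,7) _ assms(8)] by simp
qed

end
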